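(* Let $E\subset\mathbb{H}$ be a Levi-Civita plane and let $E'\subset\mathbb{IH}$ be its image under the Hopf map $z\mapsto\bar z i z$. Then there exist identifications (real-linear isomorphisms) $E\cong\mathbb{C}$ and $E'\cong\mathbb{C}$ under which the restriction of the Hopf map to $E$ becomes $$\mathbb{C}\to\mathbb{C},\quad z\mapsto z^2,$$ and moreover the restriction to $T^*E$ (where $z\neq0$) of the Kustaanheimo-Stiefel mapping $K.S.:(z,w)\mapsto\left(\bar z i z,\dfrac{\bar z i w}{2|z|^2}\right)$ becomes the Levi-Civita mapping $$L.C.:T^*(\mathbb{C}\setminus\{0\})\to T^*\mathbb{C},\quad (z,w)\mapsto\left(z^2,\dfrac{w}{2\bar z}\right).$$
   Context: $\mathbb{H}$ denotes the quaternions, $\mathbb{IH}$ the purely imaginary quaternions. A Levi-Civita plane is a real 2-dimensional linear subspace of $\mathbb{H}$ spanned by two vectors $v_1,v_2$ satisfying the bilinear relation $BL(v_1,v_2):=Re\{\bar v_1 i v_2\}=0$. The image $E'$ of such a plane under the Hopf map is a plane through the origin in $\mathbb{IH}$. $T^*E$ is identified with $E\times E\subset\mathbb{H}\times\mathbb{H}$ (base point $z$, fibre $w$), $T^*E'$ with $E'\times E'$, and $T^*\mathbb{C}$ with $\mathbb{C}\times\mathbb{C}$; the identification of $E$ (resp. $E'$) with $\mathbb{C}$ is applied to both factors. *)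

theory Defs
  imports "HOL-Analysis.Analysis"
begin

datatype quat = Quat (qRe: real) (qI: real) (qJ: real) (qK: real)

lemma quat_eqI:
  "qRe x = qRe y \<Longrightarrow> qI x = qI y \<Longrightarrow> qJ x = qJ y \<Longrightarrow> qK x = qK y \<Longrightarrow> x = y"
  by (rule quat.expand) simp

instantiation quat :: ring_1
begin

definition "0 = Quat 0 0 0 0"
definition "1 = Quat 1 0 0 0"
definition "x + y = Quat (qRe x + qRe y) (qI x + qI y) (qJ x + qJ y) (qK x + qK y)"
definition "- x = Quat (- qRe x) (- qI x) (- qJ x) (- qK x)"
definition "x - y = Quat (qRe x - qRe y) (qI x - qI y) (qJ x - qJ y) (qK x - qK y)"
definition "x * y = Quat
  (qRe x * qRe y - qI x * qI y - qJ x * qJ y - qK x * qK y)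
  (qRe x * qI y + qI x * qRe y + qJ x * qK y - qK x * qJ y)
  (qRe x * qJ y - qI x * qK y + qJ x * qRe y + qK x * qI y)
  (qRe x * qK y + qI x * qJ y - qJ x * qI y + qK x * qRe y)"

lemma quat_ring_sel [simp]:
  "qRe 0 = 0" "qI 0 = 0" "qJ 0 = 0" "qK 0 = 0"
  "qRe 1 = 1" "qI 1 = 0" "qJ 1 = 0" "qK 1 = 0"
  "qRe (x + y) = qRe x + qRe y" "qI (x + y) = qI x + qI y"
  "qJ (x + y) = qJ x + qJ y" "qK (x + y) = qK x + qK y"
  "qRe (- x) = - qRe x" "qI (- x) = - qI x" "qJ (- x) = - qJ x" "qK (- x) = - qK x"
  "qRe (x - y) = qRe x - qRe y" "qI (x - y) = qI x - qI y"
  "qJ (x - y) = qJ x - qJ y" "qK (x - y) = qK x - qK y"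
  "qRe (x * y) = qRe x * qRe y - qI x * qI y - qJ x * qJ y - qK x * qK y"
  "qI (x * y) = qRe x * qI y + qI x * qRe y + qJ x * qK y - qK x * qJ y"
  "qJ (x * y) = qRe x * qJ y - qI x * qK y + qJ x * qRe y + qK x * qI y"
  "qK (x * y) = qRe x * qK y + qI x * qJ y - qJ x * qI y + qK x * qRe y"
  by (simp_all add: zero_quat_def one_quat_def plus_quat_def uminus_quat_def
      minus_quat_def times_quat_def)

instance
proof
  fix x y z :: quat
  show "0 \<noteq> (1 :: quat)" by (simp add: zero_quat_def one_quat_def)
qed (rule quat_eqI; simp add: algebra_simps)+

end

instantiation quat :: real_algebra_1
begin

definition "scaleR r x = Quat (r * qRe x) (r * qI x) (r * qJ x) (r * qK x)"

lemma quat_scaleR_sel [simp]: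
  "qRe (r *\<^sub>R x) = r * qRe x" "qI (r *\<^sub>R x) = r * qI x"
  "qJ (r *\<^sub>R x) = r * qJ x" "qK (r *\<^sub>R x) = r * qK x"
  by (simp_all add: scaleR_quat_def)

instance
  by standard (rule quat_eqI; simp add: algebra_simps)+

end

definition qcnj :: "quat \<Rightarrow> quat" where
  "qcnj q = Quat (qRe q) (- qI q) (- qJ q) (- qK q)"

lemma qcnj_sel [simp]:
  "qRe (qcnj q) = qRe q" "qI (qcnj q) = - qI q" "qJ (qcnj q) = - qJ q" "qK (qcnj q) = - qK q"
  by (simp_all add: qcnj_def)

instantiation quat :: real_inner
begin

definition "inner x y = qRe x * qRe y + qI x * qI y + qJ x * qJ y + qK x * qK y"
definition "norm (x :: quat) = sqrt (inner x x)"
definition "sgn (x :: quat) = x /\<^sub>R norm x"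
definition "dist (x :: quat) y = norm (x - y)"
definition "(uniformity :: (quat \<times> quat) filter) =
  (INF e\<in>{0<..}. principal {(x, y). dist x y < e})"
definition "open (U :: quat set) \<longleftrightarrow>
  (\<forall>x\<in>U. \<forall>\<^sub>F (x', y) in uniformity. x' = x \<longrightarrow> y \<in> U)"

instance
proof
  fix x y z :: quat and r :: real
  show "inner x y = inner y x" "inner (x + y) z = inner x z + inner y z"
    "inner (r *\<^sub>R x) y = r * inner x y"
    by (simp_all add: inner_quat_def algebra_simps)
  show "0 \<le> inner x x" by (simp add: inner_quat_def)
  show "inner x x = 0 \<longleftrightarrow> x = 0"
  proof
    assume "inner x x = 0"
    then have "(qRe x)\<^sup>2 + (qI x)\<^sup>2 + (qJ x)\<^sup>2 + (qK x)\<^sup>2 = 0"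
      by (simp add: inner_quat_def power2_eq_square)
    then show "x = 0"
      by (intro quat_eqI; simp add: add_nonneg_eq_0_iff)
  qed (simp add: inner_quat_def)
qed (simp_all add: norm_quat_def sgn_quat_def dist_quat_def uniformity_quat_def open_quat_def)

end

lemma quat_norm_squared: "(norm (x :: quat))\<^sup>2 = (qRe x)\<^sup>2 + (qI x)\<^sup>2 + (qJ x)\<^sup>2 + (qK x)\<^sup>2"
  unfolding power2_norm_eq_inner by (simp add: inner_quat_def power2_eq_square)

lemma qcnj_mult_self: "qcnj x * x = (norm x)\<^sup>2 *\<^sub>R 1" "x * qcnj x = (norm x)\<^sup>2 *\<^sub>R 1"
  by (rule quat_eqI; simp add: quat_norm_squared; simp add: power2_eq_square)+

instantiation quat :: real_normed_div_algebra
begin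

definition "inverse (x :: quat) = qcnj x /\<^sub>R (norm x)\<^sup>2"
definition "x div (y :: quat) = x * inverse y"

instance
proof
  fix x y :: quat
  show "x \<noteq> 0 \<Longrightarrow> inverse x * x = 1" "x \<noteq> 0 \<Longrightarrow> x * inverse x = 1"
    by (simp_all add: inverse_quat_def qcnj_mult_self)
  show "x div y = x * inverse y" by (simp add: divide_quat_def)
  show "inverse (0 :: quat) = 0" by (rule quat_eqI; simp add: inverse_quat_def)
  have "(norm (x * y))\<^sup>2 = (norm x * norm y)\<^sup>2"
    unfolding power_mult_distrib quat_norm_squared quat_ring_sel
    by (simp add: power2_eq_square algebra_simps)
  then show "norm (x * y) = norm x * norm y"
    by (simp add: power2_eq_iff_nonneg)
qed

end

definition quat_i :: quat where
  "quat_i = Quat 0 1 0 0"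

definition imaginary_quats :: "quat set" where
  "imaginary_quats = {q. qRe q = 0}"

definition BL :: "quat \<Rightarrow> quat \<Rightarrow> real" where
  "BL v w = qRe (qcnj v * quat_i * w)"

definition Levi_Civita_plane :: "quat set \<Rightarrow> bool" where
  "Levi_Civita_plane E \<longleftrightarrow> dim E = 2 \<and> (\<exists>v\<^sub>1 v\<^sub>2. E = span {v\<^sub>1, v\<^sub>2} \<and> BL v\<^sub>1 v\<^sub>2 = 0)"

definition hopf :: "quat \<Rightarrow> quat" where
  "hopf z = qcnj z * quat_i * z"

definition KS :: "quat \<times> quat \<Rightarrow> quat \<times> quat" where
  "KS = (\<lambda>(z, w). (hopf z, (qcnj z * quat_i * w) /\<^sub>R (2 * (norm z)\<^sup>2)))"

definition LC :: "complex \<times> complex \<Rightarrow> complex \<times> complex" where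
  "LC = (\<lambda>(z, w). (z\<^sup>2, w / (2 * cnj z)))"

text \<open>An isomorphism between linear subspaces; the values of the function outside
  \<open>V\<close> are irrelevant.\<close>

definition real_linear_iso ::
    "('a::real_vector \<Rightarrow> 'b::real_vector) \<Rightarrow> 'a set \<Rightarrow> 'b set \<Rightarrow> bool" where
  "real_linear_iso f V W \<longleftrightarrow> subspace V \<and> subspace W \<and>
     (\<forall>x\<in>V. \<forall>y\<in>V. f (x + y) = f x + f y) \<and>
     (\<forall>c. \<forall>x\<in>V. f (c *\<^sub>R x) = c *\<^sub>R f x) \<and>
     bij_betw f V W"

text \<open>For a linear subspace \<open>E\<close> the cotangent bundle consists of pairs of
  base point and fibre coordinate.\<close>

abbreviation cotangent :: "'a set \<Rightarrow> ('a \<times> 'a) set" where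
  "cotangent E \<equiv> E \<times> E"

end

theory Submission
  imports Defs
begin

text \<open>
  Left multiplication trivialises the geometry of a Levi-Civita plane. Let \<open>u\<close> be a unit
  vector of \<open>E\<close> and write \<open>x*\<close> for the conjugate of \<open>x\<close>. Then \<open>u\<^sup>-\<^sup>1 E\<close> contains \<open>1\<close>, so it is
  a slice \<open>\<real> + \<real>q\<close> with \<open>q\<close> a unit imaginary quaternion, that is, a copy of \<open>\<complex>\<close> inside the
  quaternions (lemma \<open>Levi_Civita_plane_slice\<close>). Let \<open>a = u* i u\<close>, the Hopf image of \<open>u\<close>. The
  relation \<open>BL = 0\<close> on \<open>E\<close> says that \<open>a q\<close> has real part \<open>0\<close>, i.e. that the imaginary
  quaternions \<open>a\<close> and \<open>q\<close> are orthogonal. Hence they anticommute, so \<open>\<zeta>* a = a \<zeta>\<close> for \<open>\<zeta>\<close> in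
  the slice, and the polarised Hopf map becomes complex multiplication (lemma
  \<open>polarised_hopf_slice\<close>): \<open>(u \<zeta>)* i (u \<omega>) = \<zeta>* a \<omega> = a (\<zeta> \<omega>)\<close>.

  Therefore \<open>E' = a (\<real> + \<real>q)\<close>, and the inverses of \<open>\<zeta> \<mapsto> u \<zeta>\<close> and of \<open>\<zeta> \<mapsto> a \<zeta>\<close> are the
  two identifications: the case \<open>\<omega> = \<zeta>\<close> gives the squaring map, and dividing by
  \<open>2 |u \<zeta>|\<^sup>2 = 2 \<zeta> \<zeta>*\<close> gives the fibre part of the Levi-Civita map.
\<close>

lemma qcnj_mult: "qcnj (x * y) = qcnj y * qcnj x"
  by (rule quat_eqI) (simp_all add: algebra_simps)

lemma norm_qcnj [simp]: "norm (qcnj x) = norm x"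
  by (simp add: norm_quat_def inner_quat_def)

lemma hopf_imaginary: "hopf z \<in> imaginary_quats"
  by (simp add: hopf_def imaginary_quats_def quat_i_def algebra_simps)

lemma norm_hopf: "norm (hopf z) = (norm z)\<^sup>2"
proof -
  have "norm quat_i = 1"
    by (simp add: norm_quat_def inner_quat_def quat_i_def)
  then show ?thesis
    by (simp add: hopf_def norm_mult power2_eq_square)
qed

lemma BL_bilinear:
  "BL (r *\<^sub>R v) w = r * BL v w" "BL v (r *\<^sub>R w) = r * BL v w"
  "BL v (w - w') = BL v w - BL v w'"
  by (simp_all add: BL_def algebra_simps)

lemma BL_self [simp]: "BL v v = 0"
  by (simp add: BL_def quat_i_def algebra_simps)

text \<open>For imaginary quaternions \<open>a q + q a\<close> is real and equals \<open>-2\<close> times the inner product of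
  \<open>a\<close> and \<open>q\<close>.\<close>

lemma orthogonal_imaginary_anticommute:
  assumes "qRe a = 0" "qRe q = 0" "qRe (a * q) = 0"
  shows "q * a = - (a * q)"
  using assms by (intro quat_eqI) (auto simp: algebra_simps)

lemma unit_imaginary_square:
  assumes "qRe q = 0" "norm q = 1"
  shows "q * q = - 1"
proof -
  have "qcnj q = - q"
    using assms by (intro quat_eqI) simp_all
  then have "- (q * q) = 1"
    using qcnj_mult_self(1)[of q] assms(2) by simp
  then show ?thesis
    by (metis minus_minus)
qed

section \<open>Complex slices of the quaternions\<close>

definition slice :: "quat \<Rightarrow> complex \<Rightarrow> quat" where
  "slice q \<zeta> = Re \<zeta> *\<^sub>R 1 + Im \<zeta> *\<^sub>R q"

lemma slice_mult:
  assumes "q * q = - 1"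
  shows "slice q (\<zeta> * \<omega>) = slice q \<zeta> * slice q \<omega>"
  using assms by (simp add: slice_def algebra_simps)

lemma qcnj_slice:
  assumes "qRe q = 0"
  shows "qcnj (slice q \<zeta>) = slice q (cnj \<zeta>)"
  using assms by (intro quat_eqI) (simp_all add: slice_def)

lemma norm_slice:
  assumes "qRe q = 0" "norm q = 1"
  shows "norm (slice q \<zeta>) = norm \<zeta>"
proof -
  have "(qI q)\<^sup>2 + (qJ q)\<^sup>2 + (qK q)\<^sup>2 = 1"
    using quat_norm_squared[of q] assms by simp
  then have "(Im \<zeta>)\<^sup>2 * (qI q)\<^sup>2 + (Im \<zeta>)\<^sup>2 * (qJ q)\<^sup>2 + (Im \<zeta>)\<^sup>2 * (qK q)\<^sup>2 = (Im \<zeta>)\<^sup>2"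
    by (metis distrib_left mult.right_neutral)
  then have "(norm (slice q \<zeta>))\<^sup>2 = (norm \<zeta>)\<^sup>2"
    using assms(1) by (simp add: quat_norm_squared cmod_power2 slice_def power_mult_distrib)
  then show ?thesis
    by (simp add: power2_eq_iff_nonneg)
qed

lemma linear_mult_slice: "linear (\<lambda>\<zeta>. c * slice q \<zeta>)"
  by (rule linearI) (simp_all add: slice_def algebra_simps)

lemma inj_mult_slice:
  assumes "qRe q = 0" "norm q = 1" "c \<noteq> 0"
  shows "inj (\<lambda>\<zeta>. c * slice q \<zeta>)"
proof -
  have "\<zeta> = 0" if "c * slice q \<zeta> = 0" for \<zeta>
    using that norm_slice[OF assms(1,2), of \<zeta>] assms(3) by simp
  then show ?thesis
    using linear_injective_0[OF linear_mult_slice] by blast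
qed

text \<open>The step where the bilinear relation enters: an imaginary \<open>a\<close> orthogonal to \<open>q\<close> can be
  moved past an element of the slice at the cost of a conjugation, which undoes the conjugation
  in \<open>qcnj (u * \<zeta>)\<close>.\<close>

lemma polarised_hopf_slice:
  assumes "qRe q = 0" "norm q = 1" "BL u (u * q) = 0"
  shows "qcnj (u * slice q \<zeta>) * quat_i * (u * slice q \<omega>) = hopf u * slice q (\<zeta> * \<omega>)"
proof -
  have "qRe (hopf u * q) = 0"
    using assms(3) by (simp only: BL_def hopf_def mult.assoc)
  then have "q * hopf u = - (hopf u * q)"
    using hopf_imaginary[of u] assms(1)
    by (intro orthogonal_imaginary_anticommute) (auto simp: imaginary_quats_def)
  then have "slice q (cnj \<zeta>) * hopf u = hopf u * slice q \<zeta>"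
    by (simp add: slice_def algebra_simps)
  moreover have "qcnj (u * slice q \<zeta>) * quat_i * (u * slice q \<omega>)
      = slice q (cnj \<zeta>) * hopf u * slice q \<omega>"
    by (simp only: qcnj_mult qcnj_slice[OF assms(1)] hopf_def mult.assoc)
  ultimately show ?thesis
    using assms by (simp add: slice_mult unit_imaginary_square mult.assoc)
qed

section \<open>Levi-Civita planes as translated slices\<close>

text \<open>If \<open>v\<^sub>1, v\<^sub>2\<close> span \<open>E\<close>, then \<open>v\<^sub>2 = v\<^sub>1 p\<close> for some quaternion \<open>p\<close>, and \<open>q\<close> is the
  normalised imaginary part of \<open>p\<close>; this part is nonzero because \<open>E\<close> is not a line.\<close>

lemma Levi_Civita_plane_slice:
  assumes "Levi_Civita_plane E"
  obtains u q where "norm u = 1" "qRe q = 0" "norm q = 1" "BL u (u * q) = 0"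
    "E = range (\<lambda>\<zeta>. u * slice q \<zeta>)"
proof -
  obtain v1 v2 where dim: "dim E = 2" and E: "E = span {v1, v2}" and BL: "BL v1 v2 = 0"
    using assms by (auto simp: Levi_Civita_plane_def)
  have not_line: "\<not> E \<subseteq> span {v}" for v
    using dim dim_le_card[of E "{v}"] by auto
  have "v1 \<noteq> 0"
    using not_line[of v2] by (auto simp: E)
  define p where "p = inverse v1 * v2"
  define m where "m = p - qRe p *\<^sub>R 1"
  define u where "u = v1 /\<^sub>R norm v1"
  define q where "q = m /\<^sub>R norm m"
  have v1m: "v1 * m = v2 - qRe p *\<^sub>R v1"
    using \<open>v1 \<noteq> 0\<close> by (simp add: m_def p_def right_diff_distrib flip: mult.assoc)
  have "m \<noteq> 0"
  proof
    assume "m = 0"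
    then have "v2 = qRe p *\<^sub>R v1"
      using v1m by simp
    then have "{v1, v2} \<subseteq> span {v1}"
      by (auto intro: span_base span_scale)
    then have "E \<subseteq> span {v1}"
      unfolding E by (rule span_minimal) (rule subspace_span)
    then show False
      using not_line by blast
  qed
  have v1: "v1 = norm v1 *\<^sub>R u" and m: "m = norm m *\<^sub>R q"
    using \<open>v1 \<noteq> 0\<close> \<open>m \<noteq> 0\<close> by (simp_all add: u_def q_def)
  have uq: "u * q = (1 / (norm v1 * norm m)) *\<^sub>R (v2 - qRe p *\<^sub>R v1)"
    by (simp add: u_def q_def field_simps flip: v1m)
  show ?thesis
  proof
    show "norm u = 1" "norm q = 1"
      using \<open>v1 \<noteq> 0\<close> \<open>m \<noteq> 0\<close> by (simp_all add: u_def q_def)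
    show "qRe q = 0"
      by (simp add: q_def m_def)
    show "BL u (u * q) = 0"
      unfolding uq by (simp add: u_def BL_bilinear BL)
    show "E = range (\<lambda>\<zeta>. u * slice q \<zeta>)"
    proof
      have "v1 = u * slice q (complex_of_real (norm v1))"
        by (subst v1) (simp add: slice_def)
      moreover have "v2 = u * slice q (Complex (norm v1 * qRe p) (norm v1 * norm m))"
      proof -
        have "v2 = qRe p *\<^sub>R v1 + v1 * m"
          by (simp add: v1m)
        also have "\<dots> = qRe p *\<^sub>R (norm v1 *\<^sub>R u) + (norm v1 *\<^sub>R u) * (norm m *\<^sub>R q)"
          using v1 m by metis
        finally show ?thesis
          by (simp add: slice_def algebra_simps)
      qed
      ultimately have "{v1, v2} \<subseteq> range (\<lambda>\<zeta>. u * slice q \<zeta>)"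
        by blast
      then show "E \<subseteq> range (\<lambda>\<zeta>. u * slice q \<zeta>)"
        unfolding E by (intro span_minimal linear_subspace_image[OF linear_mult_slice]) auto
    next
      have "v1 \<in> E" "v2 \<in> E"
        by (auto simp: E intro: span_base)
      then have "u \<in> E" "u * q \<in> E"
        unfolding uq unfolding u_def E by (simp_all add: span_scale span_diff)
      then show "range (\<lambda>\<zeta>. u * slice q \<zeta>) \<subseteq> E"
        by (auto simp: slice_def distrib_left E span_add span_scale)
    qed
  qed
qed

lemma real_linear_iso_inv:
  assumes "linear f" "inj f"
  shows "real_linear_iso (inv f) (range f) UNIV"
proof -
  have "inv f (f x + f y) = x + y" for x y
    using assms by (metis linear_add inv_f_f)
  moreover have "inv f (c *\<^sub>R f x) = c *\<^sub>R x" for c x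
    using assms by (metis linear_cmul inv_f_f)
  moreover have "bij_betw (inv f) (range f) UNIV"
    using assms(2) by (intro bij_betw_inv_into) (simp add: bij_betw_def)
  ultimately show ?thesis
    using assms by (auto simp: real_linear_iso_def linear_subspace_image)
qed

theorem proposition3p3:
  fixes E E' :: "quat set"
  assumes "Levi_Civita_plane E"
    and "E' = hopf ` E"
  shows "E' \<subseteq> imaginary_quats \<and>
    (\<exists>(\<phi> :: quat \<Rightarrow> complex) (\<psi> :: quat \<Rightarrow> complex).
       real_linear_iso \<phi> E UNIV \<and> real_linear_iso \<psi> E' UNIV \<and>
       (\<forall>z\<in>E. \<psi> (hopf z) = (\<phi> z)\<^sup>2) \<and>
       (\<forall>(z, w)\<in>cotangent E. z \<noteq> 0 \<longrightarrow>
          KS (z, w) \<in> cotangent E' \<and>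
          map_prod \<psi> \<psi> (KS (z, w)) = LC (map_prod \<phi> \<phi> (z, w))))"
proof -
  obtain u q where u: "norm u = 1" and q: "qRe q = 0" "norm q = 1" and BL: "BL u (u * q) = 0"
    and E: "E = range (\<lambda>\<zeta>. u * slice q \<zeta>)"
    using Levi_Civita_plane_slice[OF assms(1)] by metis
  define f where "f = (\<lambda>\<zeta>. u * slice q \<zeta>)"
  define g where "g = (\<lambda>\<zeta>. hopf u * slice q \<zeta>)"
  have lin: "linear f" "linear g"
    by (simp_all add: f_def g_def linear_mult_slice)
  have "u \<noteq> 0" "hopf u \<noteq> 0"
    using u norm_hopf[of u] by auto
  then have inj: "inj f" "inj g"
    using q by (simp_all add: f_def g_def inj_mult_slice)
  have norm_f: "norm (f \<zeta>) = norm \<zeta>" for \<zeta>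
    by (simp add: f_def norm_mult u norm_slice[OF q])
  have polar: "qcnj (f \<zeta>) * quat_i * f \<omega> = g (\<zeta> * \<omega>)" for \<zeta> \<omega>
    unfolding f_def g_def by (rule polarised_hopf_slice[OF q BL])
  then have hopf_f: "hopf (f \<zeta>) = g (\<zeta>\<^sup>2)" for \<zeta>
    by (simp add: hopf_def power2_eq_square)
  have Ef: "E = range f"
    by (simp add: E f_def)
  have Eg: "E' = range g"
  proof
    show "E' \<subseteq> range g"
      by (auto simp: assms(2) Ef hopf_f)
    \<comment> \<open>Every complex number is a square, so the Hopf map is onto the whole plane.\<close>
    have "g \<zeta> = hopf (f (csqrt \<zeta>))" for \<zeta>
      by (simp add: hopf_f)
    then show "range g \<subseteq> E'"
      by (auto simp: assms(2) Ef)
  qed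
  have KS_f: "KS (f \<zeta>, f \<omega>) = (g (\<zeta>\<^sup>2), g (\<omega> / (2 * cnj \<zeta>)))" if "\<zeta> \<noteq> 0" for \<zeta> \<omega>
  proof -
    have "(\<zeta> * \<omega>) /\<^sub>R (2 * (norm \<zeta>)\<^sup>2) = \<omega> / (2 * cnj \<zeta>)"
      using that complex_norm_square[of \<zeta>] by (simp add: scaleR_conv_of_real field_simps)
    moreover have "g (\<zeta> * \<omega>) /\<^sub>R (2 * (norm \<zeta>)\<^sup>2) = g ((\<zeta> * \<omega>) /\<^sub>R (2 * (norm \<zeta>)\<^sup>2))"
      by (simp only: linear_cmul[OF lin(2)])
    ultimately show ?thesis
      by (simp add: KS_def hopf_f polar norm_f)
  qed
  have "E' \<subseteq> imaginary_quats"
    using assms(2) hopf_imaginary by auto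
  moreover have "real_linear_iso (inv f) E UNIV" "real_linear_iso (inv g) E' UNIV"
    using lin inj by (simp_all add: Ef Eg real_linear_iso_inv)
  moreover have "\<forall>z\<in>E. inv g (hopf z) = (inv f z)\<^sup>2"
    using inj by (auto simp: Ef hopf_f)
  moreover have "KS (z, w) \<in> cotangent E' \<and>
      map_prod (inv g) (inv g) (KS (z, w)) = LC (map_prod (inv f) (inv f) (z, w))"
    if zw: "z \<in> E" "w \<in> E" and "z \<noteq> 0" for z w
  proof -
    obtain \<zeta> \<omega> where "z = f \<zeta>" "w = f \<omega>"
      using zw by (auto simp: Ef)
    moreover from this have "\<zeta> \<noteq> 0"
      using \<open>z \<noteq> 0\<close> linear_0[OF lin(1)] by auto
    ultimately show ?thesis
      using inj by (simp add: KS_f Eg LC_def)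
  qed
  ultimately show ?thesis
    by (intro conjI exI[of _ "inv f"] exI[of _ "inv g"]) auto
qed

end
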